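(* Let $w_{001}(n)$ be the number of weak ascent sequences of length $n$ that avoid the pattern $001$. Then, as formal power series, $$\sum_{n\ge 1} w_{001}(n)\,x^n=\frac{x}{1-2x}.$$
   Context: For a word $u=u_1\cdots u_\ell$ of non-negative integers, $\mathrm{wasc}(u)$ denotes the number of weak ascents of $u$, i.e. the number of positions $j$ with $1\le j\le \ell-1$ and $u_j\le u_{j+1}$. A weak ascent sequence of length $n\ge 1$ is a word $w=w_1w_2\cdots w_n$ of non-negative integers with $w_1=0$ and $w_i\le \mathrm{wasc}(w_1\cdots w_{i-1})+1$ for $i=2,\dots,n$. The word $w$ contains a pattern $p=p_1\cdots p_k$ if there are indices $i_1<\cdots<i_k$ such that $w_{i_1}\cdots w_{i_k}$ is order-isomorphic to $p$ (for all $a,b$: $w_{i_a}<w_{i_b}$ iff $p_a<p_b$, and $w_{i_a}=w_{i_b}$ iff $p_a=p_b$); otherwise $w$ avoids $p$. *)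

theory Defs
  imports "HOL-Computational_Algebra.Formal_Power_Series"
begin

(* Words over the non-negative integers are lists of type nat list; list positions are
   0-based, so the letter u_j of the 1-based notation is u ! (j - 1). *)

definition wasc :: "nat list \<Rightarrow> nat" where
  "wasc u = card {j. Suc j < length u \<and> u ! j \<le> u ! Suc j}"

(* take i w is the prefix preceding the letter w ! i. *)
definition weak_ascent_seq :: "nat list \<Rightarrow> bool" where
  "weak_ascent_seq w \<longleftrightarrow>
     length w \<ge> 1 \<and> w ! 0 = 0 \<and>
     (\<forall>i. 1 \<le> i \<and> i < length w \<longrightarrow> w ! i \<le> wasc (take i w) + 1)"

definition order_isomorphic :: "nat list \<Rightarrow> nat list \<Rightarrow> bool" where
  "order_isomorphic u v \<longleftrightarrow>
     length u = length v \<and>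
     (\<forall>a < length u. \<forall>b < length u.
        (u ! a < u ! b \<longleftrightarrow> v ! a < v ! b) \<and> (u ! a = u ! b \<longleftrightarrow> v ! a = v ! b))"

(* f a is the position in w of the letter that plays the role of p ! a. *)
definition contains_pattern :: "nat list \<Rightarrow> nat list \<Rightarrow> bool" where
  "contains_pattern w p \<longleftrightarrow>
     (\<exists>f :: nat \<Rightarrow> nat.
        strict_mono_on {..<length p} f \<and>
        (\<forall>a < length p. f a < length w) \<and>
        order_isomorphic (map (\<lambda>a. w ! f a) [0..<length p]) p)"

definition avoids_pattern :: "nat list \<Rightarrow> nat list \<Rightarrow> bool" where
  "avoids_pattern w p \<longleftrightarrow> \<not> contains_pattern w p"

(* The letters of a weak ascent sequence of length n are at most n,
   so the set counted here is finite. *)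
definition num_avoiding :: "nat list \<Rightarrow> nat \<Rightarrow> nat" where
  "num_avoiding p n = card {w. weak_ascent_seq w \<and> length w = n \<and> avoids_pattern w p}"

end

(* A weak ascent sequence that avoids 001 climbs 0, 1, ..., k as long as it is strictly increasing.
   The first letter that breaks this run is at most k, hence a repetition, and avoidance of 001 then
   forbids any larger letter afterwards; so every later letter is again a repetition and the rest is
   weakly decreasing.  There are (n - 1 choose k) such words of length n with maximum k, and summing
   over k gives 2 ^ (n - 1). *)
theory Submission
  imports Defs
begin

section \<open>Weakly decreasing words over a bounded alphabet\<close>

definition decreasing_lists :: "nat \<Rightarrow> nat \<Rightarrow> nat list set" where
  "decreasing_lists k m = {t. length t = m \<and> sorted_wrt (\<ge>) t \<and> set t \<subseteq> {..k}}"

lemma decreasing_lists_0_right [simp]: "decreasing_lists k 0 = {[]}"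
  by (auto simp: decreasing_lists_def)

lemma decreasing_lists_0_Suc:
  "decreasing_lists 0 (Suc m) = Cons 0 ` decreasing_lists 0 m"
  by (fastforce simp: decreasing_lists_def length_Suc_conv image_iff)

text \<open>The first letter is the largest: either it equals \<open>Suc k\<close> and can be
  removed, or all letters are at most \<open>k\<close>. On cardinalities this is Pascal's
  rule.\<close>

lemma decreasing_lists_Suc_Suc:
  "decreasing_lists (Suc k) (Suc m) =
     Cons (Suc k) ` decreasing_lists (Suc k) m \<union> decreasing_lists k (Suc m)"
proof (intro equalityI subsetI)
  fix t assume "t \<in> decreasing_lists (Suc k) (Suc m)"
  then obtain a s where t: "t = a # s" "length s = m" "sorted_wrt (\<ge>) s" "\<forall>b\<in>set s. b \<le> a"
    "a \<le> Suc k" "set s \<subseteq> {..Suc k}"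
    by (auto simp: decreasing_lists_def length_Suc_conv)
  show "t \<in> Cons (Suc k) ` decreasing_lists (Suc k) m \<union> decreasing_lists k (Suc m)"
  proof (cases "a = Suc k")
    case True
    with t show ?thesis by (auto simp: decreasing_lists_def)
  next
    case False
    with t have "a \<le> k" by simp
    with t have "t \<in> decreasing_lists k (Suc m)"
      by (force simp: decreasing_lists_def)
    then show ?thesis ..
  qed
next
  fix t assume "t \<in> Cons (Suc k) ` decreasing_lists (Suc k) m \<union> decreasing_lists k (Suc m)"
  then show "t \<in> decreasing_lists (Suc k) (Suc m)"
    by (fastforce simp: decreasing_lists_def)
qed

lemma finite_decreasing_lists: "finite (decreasing_lists k m)"
  by (rule finite_subset[OF _ finite_lists_length_eq[of "{..k}" m]])
    (auto simp: decreasing_lists_def)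

text \<open>Stars and bars: these words are the multisets of size \<open>m\<close> drawn from
  \<open>k + 1\<close> letters. The double induction follows Pascal's rule.\<close>

lemma card_decreasing_lists: "card (decreasing_lists k m) = (m + k) choose k"
proof (induction k arbitrary: m)
  case 0
  show ?case
    by (induction m) (auto simp: decreasing_lists_0_Suc card_image)
next
  case (Suc k)
  show ?case
  proof (induction m)
    case 0
    show ?case by simp
  next
    case (Suc m)
    have "Cons (Suc k) ` decreasing_lists (Suc k) m \<inter> decreasing_lists k (Suc m) = {}"
      by (auto simp: decreasing_lists_def)
    then show ?case
      \<comment> \<open>The inner hypothesis counts the words starting with \<open>Suc k\<close>;
        the outer one, taken at length \<open>Suc m\<close>, counts the others.\<close>
      using Suc.IH \<open>\<And>m. card (decreasing_lists k m) = (m + k) choose k\<close>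
      by (simp add: decreasing_lists_Suc_Suc card_Un_disjoint finite_decreasing_lists card_image)
  qed
qed

text \<open>Only \<open>length u - 1\<close> adjacent pairs exist. This caps the letter that follows
  a strictly increasing run.\<close>

lemma wasc_less_length:
  assumes "u \<noteq> []" shows "wasc u < length u"
proof -
  have "wasc u \<le> card {..<length u - 1}"
    unfolding wasc_def by (rule card_mono) auto
  with assms show ?thesis
    by (cases u) auto
qed

section \<open>Occurrences of 001 as triples of positions\<close>

lemma order_isomorphic_001_iff:
  "order_isomorphic [a, b, c] [0, 0, 1] \<longleftrightarrow> a = b \<and> b < c"
  by (auto simp: order_isomorphic_def All_less_Suc)

lemma avoids_001_iff:
  "avoids_pattern w [0, 0, 1] \<longleftrightarrow>
     (\<forall>i j l. i < j \<and> j < l \<and> l < length w \<and> w ! i = w ! j \<longrightarrow> w ! l \<le> w ! j)"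
proof -
  have map3: "map g [0..<length [0, 0, 1::nat]] = [g 0, g 1, g 2]" for g :: "nat \<Rightarrow> nat"
    by (simp add: numeral_2_eq_2)
  have "contains_pattern w [0, 0, 1] \<longleftrightarrow>
     (\<exists>i j l. i < j \<and> j < l \<and> l < length w \<and> w ! i = w ! j \<and> w ! j < w ! l)"
    (is "_ \<longleftrightarrow> ?R")
  proof
    assume "contains_pattern w [0, 0, 1]"
    then obtain f where f: "strict_mono_on {..<length [0, 0, 1::nat]} f"
      "\<forall>a<length [0, 0, 1::nat]. f a < length w" "w ! f 0 = w ! f 1" "w ! f 1 < w ! f 2"
      unfolding contains_pattern_def map3 order_isomorphic_001_iff by blast
    have "f 0 < f 1" "f 1 < f 2"
      using f(1) by (auto simp: strict_mono_on_def)
    moreover have "f 2 < length w" using f(2) by simp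
    ultimately show ?R using f(3,4) by blast
  next
    assume ?R
    then obtain i j l where ijl: "i < j" "j < l" "l < length w" "w ! i = w ! j" "w ! j < w ! l"
      by blast
    define f where "f a = (if a = 0 then i else if a = 1 then j else l)" for a :: nat
    have "strict_mono_on {..<length [0, 0, 1::nat]} f"
      using ijl(1,2) by (auto simp: strict_mono_on_def f_def)
    moreover have "\<forall>a<length [0, 0, 1::nat]. f a < length w"
      using ijl(1-3) by (simp add: f_def)
    moreover have "w ! f 0 = w ! f 1 \<and> w ! f 1 < w ! f 2"
      using ijl(4,5) by (simp add: f_def)
    ultimately show "contains_pattern w [0, 0, 1]"
      unfolding contains_pattern_def map3 order_isomorphic_001_iff by blast
  qed
  then show ?thesis
    unfolding avoids_pattern_def by (meson not_le)
qed

section \<open>Runs with a suitable tail are avoiding weak ascent sequences\<close>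

lemma avoids_001_run_append:
  assumes t: "sorted_wrt (\<ge>) t"
  shows "avoids_pattern ([0..<Suc k] @ t) [0, 0, 1]"
  unfolding avoids_001_iff
proof (intro allI impI, elim conjE)
  let ?w = "[0..<Suc k] @ t"
  fix i j l assume ijl: "i < j" "j < l" "l < length ?w" "?w ! i = ?w ! j"
  \<comment> \<open>The letters of the run are distinct, so the second of two equal letters lies in
    \<open>t\<close>, where nothing increases any more.\<close>
  have "\<not> j \<le> k"
    using ijl(1,4) by (auto simp: nth_append simp del: upt_Suc)
  with ijl t show "?w ! l \<le> ?w ! j"
    by (auto simp: nth_append sorted_wrt_iff_nth_less simp del: upt_Suc)
qed

lemma weak_ascent_seq_run_append:
  assumes t: "set t \<subseteq> {..k}"
  shows "weak_ascent_seq ([0..<Suc k] @ t)"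
  unfolding weak_ascent_seq_def
proof (intro conjI allI impI, goal_cases)
  let ?w = "[0..<Suc k] @ t"
  case 1 show ?case by simp
  case 2 show ?case by (simp add: nth_append del: upt_Suc)
  case (3 i)
  \<comment> \<open>The first \<open>i\<close> letters contain \<open>min i (k + 1)\<close> letters
    of the run, hence at least \<open>min (i - 1) k\<close> weak ascents.\<close>
  have "card {..<min (i - 1) k} \<le> wasc (take i ?w)"
    unfolding wasc_def
  proof (rule card_mono)
    show "finite {j. Suc j < length (take i ?w) \<and> take i ?w ! j \<le> take i ?w ! Suc j}"
      by (rule finite_subset[of _ "{..<i}"]) auto
    show "{..<min (i - 1) k} \<subseteq>
        {j. Suc j < length (take i ?w) \<and> take i ?w ! j \<le> take i ?w ! Suc j}"
    proof
      fix j assume "j \<in> {..<min (i - 1) k}"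
      then have "Suc j < i" "Suc j \<le> k" by auto
      with 3 show "j \<in> {j. Suc j < length (take i ?w) \<and> take i ?w ! j \<le> take i ?w ! Suc j}"
        by (simp add: nth_append del: upt_Suc)
    qed
  qed
  \<comment> \<open>Inside the run the letter is its own position \<open>i\<close>; beyond it, the
    letter belongs to \<open>t\<close> and is at most \<open>k\<close>.\<close>
  moreover have "?w ! i \<le> min i k"
  proof (cases "i \<le> k")
    case True
    then show ?thesis by (simp add: nth_append del: upt_Suc)
  next
    case False
    with 3 have "?w ! i \<in> set t" by (simp add: nth_append del: upt_Suc)
    with t False show ?thesis by auto
  qed
  moreover have "min i k \<le> min (i - 1) k + 1"
    by simp
  ultimately show ?case unfolding card_lessThan by linarith
qed

section \<open>Decomposing an avoider, by induction on its last letter\<close>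

lemma weak_ascent_seq_butlast:
  assumes "weak_ascent_seq (w @ [x])" "w \<noteq> []"
  shows "weak_ascent_seq w"
  unfolding weak_ascent_seq_def
proof (intro conjI allI impI)
  show "length w \<ge> 1" using assms by (cases w) auto
  show "w ! 0 = 0" using assms by (auto simp: weak_ascent_seq_def nth_append)
next
  fix i assume i: "1 \<le> i \<and> i < length w"
  then have "(w @ [x]) ! i \<le> wasc (take i (w @ [x])) + 1"
    using assms by (simp add: weak_ascent_seq_def)
  with i show "w ! i \<le> wasc (take i w) + 1" by (simp add: nth_append)
qed

lemma avoids_001_butlast:
  assumes "avoids_pattern (w @ [x]) [0, 0, 1]"
  shows "avoids_pattern w [0, 0, 1]"
  unfolding avoids_001_iff
proof (intro allI impI, elim conjE)
  fix i j l assume "i < j" "j < l" "l < length w" "w ! i = w ! j"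
  with assms[unfolded avoids_001_iff, rule_format, of i j l] show "w ! l \<le> w ! j"
    by (simp add: nth_append)
qed

lemma weak_ascent_seq_avoids_001_decompose:
  assumes "weak_ascent_seq w" "avoids_pattern w [0, 0, 1]"
  shows "\<exists>k t. w = [0..<Suc k] @ t \<and> sorted_wrt (\<ge>) t \<and> set t \<subseteq> {..k}"
  using assms
proof (induction w rule: rev_induct)
  case Nil
  then show ?case by (simp add: weak_ascent_seq_def)
next
  case (snoc x w)
  show ?case
  proof (cases "w = []")
    case True
    with snoc.prems have "x = 0" by (simp add: weak_ascent_seq_def)
    with True show ?thesis by (intro exI[of _ 0] exI[of _ "[]"]) auto
  next
    case False
    then obtain k t where w: "w = [0..<Suc k] @ t" and t: "sorted_wrt (\<ge>) t" "set t \<subseteq> {..k}"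
      using snoc weak_ascent_seq_butlast avoids_001_butlast by blast
    show ?thesis
    proof (cases t rule: rev_cases)
      case Nil
      have "x \<le> wasc w + 1"
        using snoc.prems(1) False unfolding weak_ascent_seq_def
        by (auto dest!: spec[of _ "length w"] simp: Suc_le_eq)
      \<comment> \<open>With an empty tail, \<open>w\<close> has \<open>k + 1\<close> letters and at
        most \<open>k\<close> weak ascents. So \<open>x\<close> either prolongs the run or opens the
        tail.\<close>
      also have "\<dots> \<le> Suc k"
        using wasc_less_length[OF False] w Nil by simp
      finally consider "x = Suc k" | "x \<le> k" by linarith
      then show ?thesis
      proof cases
        case 1
        with w Nil show ?thesis by (intro exI[of _ "Suc k"] exI[of _ "[]"]) simp
      next
        case 2
        with w Nil show ?thesis by (intro exI[of _ k] exI[of _ "[x]"]) simp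
      qed
    next
      case (snoc s a)
      have a: "a \<le> k" using t snoc by simp
      \<comment> \<open>As \<open>a\<close> is at most \<open>k\<close>, the run carries the letter
        \<open>a\<close> at position \<open>a\<close>. Together with the final \<open>a\<close> of
        \<open>w\<close> this is a repetition, and a larger \<open>x\<close> would complete
        001.\<close>
      have "x \<le> a"
        using \<open>avoids_pattern (w @ [x]) [0, 0, 1]\<close>
          [unfolded avoids_001_iff, rule_format, of a "length w - 1" "length w"] a
        by (simp add: w snoc nth_append del: upt_Suc)
      with t snoc have "sorted_wrt (\<ge>) (t @ [x])" "set (t @ [x]) \<subseteq> {..k}"
        by (auto simp: sorted_wrt_append intro: order_trans)
      with w show ?thesis by (metis append_assoc)
    qed
  qed
qed

section \<open>Enumeration of the avoiders\<close>

lemma avoiders_001_eq: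
  "{w. weak_ascent_seq w \<and> length w = Suc n \<and> avoids_pattern w [0, 0, 1]} =
     (\<Union>k\<le>n. (@) [0..<Suc k] ` decreasing_lists k (n - k))" (is "?L = ?R")
proof (intro equalityI subsetI)
  fix w assume "w \<in> ?L"
  then obtain k t where kt: "w = [0..<Suc k] @ t" "sorted_wrt (\<ge>) t" "set t \<subseteq> {..k}"
      and len: "length w = Suc n"
    using weak_ascent_seq_avoids_001_decompose by blast
  then have "k \<le> n" "t \<in> decreasing_lists k (n - k)"
    by (auto simp: decreasing_lists_def)
  with kt(1) show "w \<in> ?R" by blast
next
  fix w assume "w \<in> ?R"
  then obtain k t where kt: "k \<le> n" "t \<in> decreasing_lists k (n - k)" "w = [0..<Suc k] @ t"
    by blast
  then show "w \<in> ?L"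
    using weak_ascent_seq_run_append[of t k] avoids_001_run_append[of t k]
    by (auto simp: decreasing_lists_def simp del: upt_Suc)
qed

text \<open>Recovers \<open>k\<close> from the word, which makes the union over \<open>k\<close>
  disjoint.\<close>

lemma Max_run_append:
  assumes "set t \<subseteq> {..k}"
  shows "Max (set ([0..<Suc k] @ t)) = k"
  using assms by (intro Max_eqI) auto

lemma num_avoiding_001: "num_avoiding [0, 0, 1] (Suc n) = 2 ^ n"
proof -
  have "num_avoiding [0, 0, 1] (Suc n) =
      (\<Sum>k\<le>n. card ((@) [0..<Suc k] ` decreasing_lists k (n - k)))"
    unfolding num_avoiding_def avoiders_001_eq
  proof (rule card_UN_disjoint)
    show "\<forall>k\<in>{..n}. \<forall>l\<in>{..n}. k \<noteq> l \<longrightarrow>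
      (@) [0..<Suc k] ` decreasing_lists k (n - k) \<inter>
      (@) [0..<Suc l] ` decreasing_lists l (n - l) = {}"
    proof (intro ballI impI, rule ccontr)
      fix k l
      assume "k \<noteq> l" and "(@) [0..<Suc k] ` decreasing_lists k (n - k) \<inter>
        (@) [0..<Suc l] ` decreasing_lists l (n - l) \<noteq> {}"
      then obtain s t where "set s \<subseteq> {..k}" "set t \<subseteq> {..l}"
        "[0..<Suc k] @ s = [0..<Suc l] @ t"
        unfolding decreasing_lists_def by blast
      then show False using \<open>k \<noteq> l\<close> Max_run_append by metis
    qed
  qed (auto simp: finite_decreasing_lists)
  \<comment> \<open>Prepending a fixed run is injective, and \<open>(n - k) + k = n\<close> because
    \<open>k\<close> is at most \<open>n\<close>.\<close>
  also have "\<dots> = (\<Sum>k\<le>n. n choose k)"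
    by (intro sum.cong refl)
      (simp add: card_image inj_on_def card_decreasing_lists del: upt_Suc)
  finally show ?thesis by (simp add: choose_row_sum)
qed

section \<open>The generating function\<close>

theorem theorem2p1:
  shows "Abs_fps (\<lambda>n. if n \<ge> 1 then of_nat (num_avoiding [0, 0, 1] n) else 0)
         = (fps_X / (1 - 2 * fps_X) :: rat fps)"
proof -
  define A :: "rat fps"
    where "A = Abs_fps (\<lambda>n. if n \<ge> 1 then of_nat (num_avoiding [0, 0, 1] n) else 0)"
  have A_nth: "fps_nth A n = (if n = 0 then 0 else 2 ^ (n - 1))" for n
    by (cases n) (simp_all add: A_def num_avoiding_001 del: One_nat_def)
  have "A * (1 - 2 * fps_X) = A - fps_const 2 * (fps_X * A)"
    by (simp add: algebra_simps numeral_fps_const)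
  also have "\<dots> = fps_X"
  proof (rule fps_ext)
    fix n
    show "fps_nth (A - fps_const 2 * (fps_X * A)) n = fps_nth fps_X n"
      \<comment> \<open>The cases are coefficient 0, coefficient 1 (the initial value 1), and the
        later ones, where doubling cancels.\<close>
      by (cases n; cases "n - 1") (simp_all add: A_nth fps_X_nth)
  qed
  finally have *: "A * (1 - 2 * fps_X) = fps_X" .
  \<comment> \<open>The constant coefficient 1 shows that the divisor is nonzero, so it may be
    cancelled.\<close>
  have "fps_nth (1 - 2 * fps_X :: rat fps) 0 \<noteq> 0" by simp
  then have "1 - 2 * fps_X \<noteq> (0 :: rat fps)" by (metis fps_zero_nth)
  then have "A = A * (1 - 2 * fps_X) / (1 - 2 * fps_X)"
    by (rule nonzero_mult_div_cancel_right[symmetric])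
  then show ?thesis unfolding * by (simp only: A_def)
qed

end
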